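(* Let $\omega$ be a circle with center $O$ and $\xi$ an ellipse with center $O$ lying inside $\omega$. Let $(u_1,\dots,u_n)$ be a Poncelet $n$-gon for the pair $(\omega,\xi)$. Then for each $k$, $\sum_{i=1}^n\cos\angle u_iOu_{i+k}$ is constant in the Poncelet family of $n$-gons containing $(u_1,\dots,u_n)$.
   Context: Indices are mod $n$. A Poncelet $n$-gon for a pair of conics $(C,D)$, $D$ inside $C$, is a closed polygon with all vertices on $C$ and all sides tangent to $D$. By the Poncelet porism, if one such closed $n$-gon exists, then starting from any point of $C$ and successively drawing tangent lines to $D$ (in the same rotational sense) produces a closed $n$-gon; the Poncelet family is this continuous 1-parameter family. $\angle u_iOu_{i+k}\in[0,\pi]$ is the angle between the vectors $u_i-O$ and $u_{i+k}-O$. *)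

theory Defs
  imports "HOL-Analysis.Analysis"
begin

text \<open>Ellipse with center c, semi-axes a, b > 0, principal axes rotated by the
  unit complex number e (first axis along e).\<close>
definition ellipse :: "complex \<Rightarrow> real \<Rightarrow> real \<Rightarrow> complex \<Rightarrow> complex set" where
  "ellipse c a b e = {z. (Re ((z - c) / e) / a)\<^sup>2 + (Im ((z - c) / e) / b)\<^sup>2 = 1}"

definition line_through :: "complex \<Rightarrow> complex \<Rightarrow> complex set" where
  "line_through p q = {p + of_real t * (q - p) | t. True}"

text \<open>The line through the distinct points p, q is tangent to the (convex) curve D:
  it meets D in exactly one point.\<close>
definition tangent_line :: "complex set \<Rightarrow> complex \<Rightarrow> complex \<Rightarrow> bool" where
  "tangent_line D p q \<longleftrightarrow> p \<noteq> q \<and> (\<exists>!z. z \<in> D \<and> z \<in> line_through p q)"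

definition poncelet_ngon :: "complex set \<Rightarrow> complex set \<Rightarrow> nat \<Rightarrow> (nat \<Rightarrow> complex) \<Rightarrow> bool" where
  "poncelet_ngon C D n u \<longleftrightarrow> n > 0 \<and> (\<forall>i. u (i + n) = u i) \<and> (\<forall>i. u i \<in> C)
     \<and> (\<forall>i. tangent_line D (u i) (u (Suc i)))"

text \<open>Signed area (cross product) of the turn from p to q seen from c; its sign
  gives the rotational sense of the step p \<rightarrow> q around c.\<close>
definition cross_at :: "complex \<Rightarrow> complex \<Rightarrow> complex \<Rightarrow> real" where
  "cross_at c p q = Im (cnj (p - c) * (q - c))"

definition vangle :: "complex \<Rightarrow> complex \<Rightarrow> real" where
  "vangle x y = (if x = 0 \<or> y = 0 then pi / 2 else arccos ((x \<bullet> y) / (norm x * norm y)))"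

end

theory Submission
  imports Defs
begin

text \<open>
  Normalise to the unit circle and the axis-parallel ellipse with semi-axes \<open>a\<close>, \<open>b\<close>. The square
  of \<open>s x\<close> is a quadratic trigonometric polynomial in \<open>x\<close>, positive because the ellipse lies inside
  the circle. Along the flow \<open>x' = s x\<close> the quotient \<open>\<kappa> = sin (y - x) / (s x + s y)\<close> of two points
  moving with a fixed time lag is conserved. A positively oriented chord from angle \<open>x\<close> to angle \<open>y\<close>
  is tangent to the ellipse only if \<open>\<kappa> = 1\<close>; as the flow moves tangent chords to tangent chords, all
  of them span the same time lag, so the whole Poncelet family is one flow line. For a lag of \<open>k\<close>
  steps, the derivative of \<open>cos (y - x)\<close> along the flow is
  \<open>- sin (y - x) * (s y - s x) = - \<kappa> * ((s y)\<^sup>2 - (s x)\<^sup>2)\<close>, whose sum over the closed polygon vanishes.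
\<close>

subsection \<open>The flow on the circle\<close>

locale unit_circle_ellipse =
  fixes a b :: real
  assumes ab: "0 < a" "a < 1" "0 < b" "b < 1"
begin

text \<open>Up to the factor \<open>a\<^sup>2 * b\<^sup>2\<close>, the defining polynomial of the
  ellipse evaluated at \<open>cis x\<close>; positivity expresses that this point lies outside the
  ellipse.\<close>

definition g :: "real \<Rightarrow> real" where
  "g x = b\<^sup>2 * (cos x)\<^sup>2 + a\<^sup>2 * (sin x)\<^sup>2 - a\<^sup>2 * b\<^sup>2"

definition s :: "real \<Rightarrow> real" where "s x = sqrt (g x)"

definition m :: real where "m = a\<^sup>2 - b\<^sup>2"

text \<open>\<open>x\<close> and \<open>y\<close> are angles lifted to the real line; the equation is the tangency condition
  divided by \<open>1 - cos (y - x)\<close>.\<close>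
definition edge :: "real \<Rightarrow> real \<Rightarrow> bool" where
  "edge x y \<longleftrightarrow> x < y \<and> y < x + pi \<and> cos (y - x) - m * cos (x + y) = a\<^sup>2 + b\<^sup>2 - 1"

text \<open>The travel time from angle 0 to \<open>x\<close> at speed \<open>s\<close>, an elliptic
  integral.\<close>

definition elapsed :: "real \<Rightarrow> real" where "elapsed x = (LBINT y=0..x. 1 / s y)"

definition flow :: "real \<Rightarrow> real" where "flow = inv elapsed"

section \<open>The speed: positivity, upper bound and derivative\<close>

lemma sq_less_1: "a\<^sup>2 < 1" "b\<^sup>2 < 1" "a\<^sup>2 > 0" "b\<^sup>2 > 0"
  using ab by (auto simp: power_less_one_iff)

lemma g_alt: "g x = b\<^sup>2 * (1 - a\<^sup>2) * (cos x)\<^sup>2 + a\<^sup>2 * (1 - b\<^sup>2) * (sin x)\<^sup>2"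
proof -
  have "(cos x)\<^sup>2 = 1 - (sin x)\<^sup>2" by (simp add: cos_squared_eq)
  then show ?thesis unfolding g_def by algebra
qed

lemma g_pos: "g x > 0"
proof (cases "sin x = 0")
  case True
  then have "(cos x)\<^sup>2 = 1" using sin_cos_squared_add[of x] by simp
  then show ?thesis using sq_less_1 True by (simp add: g_alt)
next
  case False
  then show ?thesis unfolding g_alt using sq_less_1
    by (intro add_nonneg_pos mult_pos_pos mult_nonneg_nonneg) auto
qed

lemma s_pos: "s x > 0" and s_square: "(s x)\<^sup>2 = g x"
  using g_pos[of x] by (auto simp: s_def)

lemma g_diff: "g y - g x = m * sin (x + y) * sin (y - x)"
proof -
  have "sin (x + y) * sin (y - x) = (sin y)\<^sup>2 - (sin x)\<^sup>2"
    by (simp add: sin_times_sin cos_double_sin flip: mult_2)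
  then show ?thesis
    unfolding g_def m_def cos_squared_eq by algebra
qed

lemma s_le_1: "s x \<le> 1"
proof -
  have "g x \<le> 1 * (cos x)\<^sup>2 + 1 * (sin x)\<^sup>2" unfolding g_alt using sq_less_1
    by (intro add_mono mult_right_mono mult_le_one) auto
  then show ?thesis by (simp add: s_def)
qed

lemma s_has_derivative: "(s has_real_derivative m * sin x * cos x / s x) (at x)"
  unfolding s_def using g_pos[of x] unfolding g_def
  by (auto intro!: derivative_eq_intros simp: m_def field_simps)

lemma continuous_s: "continuous_on A s"
  using s_has_derivative by (meson DERIV_isCont continuous_at_imp_continuous_on)

section \<open>Travel time and its inverse, the flow\<close>

lemma elapsed_has_derivative: "(elapsed has_real_derivative 1 / s x) (at x)"
proof -
  \<comment> \<open>A compact interval with 0 and \<open>x\<close> in its interior: the fundamental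
    theorem gives the derivative within it, which at an interior point is the full
    derivative.\<close>
  define M where "M = \<bar>x\<bar> + 1"
  have "(elapsed has_vector_derivative 1 / s x) (at x within {-M..M})"
    unfolding elapsed_def zero_ereal_def using s_pos
    by (intro interval_integral_FTC2 continuous_intros continuous_s)
       (auto simp: M_def less_imp_neq[THEN not_sym])
  moreover have "at x within {-M..M} = at x"
    by (rule at_within_Icc_at) (auto simp: M_def)
  ultimately show ?thesis by (simp add: has_real_derivative_iff_has_vector_derivative)
qed

text \<open>Since the speed is at most 1, time grows at least as fast as the angle. This yields
  strict monotonicity and the unboundedness needed for surjectivity.\<close>

lemma elapsed_diff_ge:
  assumes "x \<le> y" shows "elapsed y - elapsed x \<ge> y - x"
proof -
  have "elapsed x - x \<le> elapsed y - y"
  proof (rule DERIV_nonneg_imp_nondecreasing[OF assms], intro exI conjI)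
    fix z
    show "((\<lambda>x. elapsed x - x) has_real_derivative (1 / s z - 1)) (at z)"
      by (auto intro!: derivative_eq_intros elapsed_has_derivative)
    show "1 / s z - 1 \<ge> 0" using s_le_1[of z] s_pos[of z] by simp
  qed
  then show ?thesis by simp
qed

lemma elapsed_less_iff: "elapsed x < elapsed y \<longleftrightarrow> x < y"
  using elapsed_diff_ge[of x y] elapsed_diff_ge[of y x] by linarith

lemma bij_elapsed: "bij elapsed"
proof (rule bijI)
  show "inj elapsed" by (rule injI) (metis elapsed_less_iff linorder_neq_iff)
  show "surj elapsed"
  proof -
    have "\<exists>x. elapsed x = t" for t
    proof -
      define M where "M = \<bar>t - elapsed 0\<bar>"
      have "elapsed (-M) \<le> t" "t \<le> elapsed M"
        using elapsed_diff_ge[of "-M" 0] elapsed_diff_ge[of 0 M] by (auto simp: M_def)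
      moreover have "-M \<le> M" by (simp add: M_def)
      ultimately show ?thesis
        using IVT[of elapsed "-M" t M] elapsed_has_derivative DERIV_isCont by blast
    qed
    then show ?thesis by (metis surjI)
  qed
qed

lemma elapsed_flow [simp]: "elapsed (flow t) = t"
  and flow_elapsed [simp]: "flow (elapsed x) = x"
  using bij_elapsed by (auto simp: flow_def bij_is_surj surj_f_inv_f bij_is_inj)

lemma flow_less_iff: "flow t < flow t' \<longleftrightarrow> t < t'"
  using elapsed_less_iff[of "flow t" "flow t'"] by simp

lemma flow_has_derivative: "(flow has_real_derivative s (flow t)) (at t)"
proof -
  have "isCont flow (elapsed (flow t))"
    by (rule isCont_inverse_function[where d = 1])
       (auto intro: DERIV_isCont elapsed_has_derivative)
  then have "DERIV flow t :> inverse (1 / s (flow t))"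
    using s_pos[of "flow t"]
    by (intro DERIV_inverse_function[where f = elapsed and a = "t - 1" and b = "t + 1"]
          elapsed_has_derivative) auto
  then show ?thesis by simp
qed

lemma s_flow_has_derivative:
  "((\<lambda>t. s (flow t)) has_real_derivative m * sin (flow t) * cos (flow t)) (at t)"
  using DERIV_chain2[OF s_has_derivative flow_has_derivative, of t] s_pos[of "flow t"] by simp

text \<open>The derivative in the starting angle is a difference of two equal values of
  \<open>1 / s\<close>. Applied to half a turn and to the total angle swept by a closed
  polygon.\<close>

lemma elapsed_shift:
  assumes "\<And>x. s (x + r) = s x"
  shows "elapsed (x + r) - elapsed x = elapsed (y + r) - elapsed y"
proof -
  have "((\<lambda>x. elapsed (x + r) - elapsed x) has_real_derivative 0) (at z)" for z
    using assms
    by (auto intro!: derivative_eq_intros DERIV_chain2[OF elapsed_has_derivative]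
        elapsed_has_derivative)
  then show ?thesis using DERIV_isconst_all by blast
qed

lemma flow_shift:
  assumes "\<And>x. s (x + r) = s x"
  shows "flow (t + (elapsed (x + r) - elapsed x)) = flow t + r"
  using elapsed_shift[OF assms, of x "flow t"]
  by (metis add_diff_cancel_left' add.commute diff_add_cancel elapsed_flow flow_elapsed)

text \<open>In the quotient rule, \<open>g_diff\<close> turns
  \<open>(s y)\<^sup>2 - (s x)\<^sup>2\<close> into \<open>m * sin (x + y) * sin (y - x)\<close>,
  while the derivatives of the two speeds add up to \<open>m * sin (x + y) * cos (y - x)\<close>; so
  the numerator cancels. The lag is arbitrary because both single edges and \<open>k\<close> steps
  are needed.\<close>

lemma flow_chord:
  fixes \<tau> :: real
  obtains \<kappa> where "\<And>t. sin (flow (t + \<tau>) - flow t) = \<kappa> * (s (flow t) + s (flow (t + \<tau>)))"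
proof -
  define Q where "Q t = sin (flow (t + \<tau>) - flow t) / (s (flow t) + s (flow (t + \<tau>)))" for t
  have "(Q has_real_derivative 0) (at t)" for t
  proof -
    define x y where "x = flow t" and "y = flow (t + \<tau>)"
    have pos: "s x + s y > 0" using s_pos by (simp add: add_pos_pos)
    have dy: "((\<lambda>t. flow (t + \<tau>)) has_real_derivative s y) (at t)"
      using DERIV_shift[of flow "s y" t \<tau>] flow_has_derivative[of "t + \<tau>"] by (simp add: y_def)
    have dsy: "((\<lambda>t. s (flow (t + \<tau>))) has_real_derivative m * sin y * cos y) (at t)"
      using DERIV_shift[of "\<lambda>t. s (flow t)" "m * sin y * cos y" t \<tau>]
        s_flow_has_derivative[of "t + \<tau>"] by (simp add: y_def)
    have dx: "(flow has_real_derivative s x) (at t)"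
      using flow_has_derivative[of t] by (simp add: x_def)
    have dsx: "((\<lambda>t. s (flow t)) has_real_derivative m * sin x * cos x) (at t)"
      using s_flow_has_derivative[of t] by (simp add: x_def)
    have *: "m * sin x * cos x + m * sin y * cos y = m * sin (x + y) * cos (y - x)"
    proof -
      have "sin (x + y) * cos (y - x) = (sin (2 * x) + sin (2 * y)) / 2"
        by (simp add: sin_times_cos)
      then show ?thesis unfolding sin_double by algebra
    qed
    have "(s y)\<^sup>2 - (s x)\<^sup>2 = m * sin (x + y) * sin (y - x)"
      using g_diff[of y x] by (simp add: s_square)
    then have 0: "cos (y - x) * (s y - s x) * (s x + s y) -
        sin (y - x) * (m * sin x * cos x + m * sin y * cos y) = 0"
      unfolding * by algebra
    have "((\<lambda>t. sin (flow (t + \<tau>) - flow t)) has_real_derivative cos (y - x) * (s y - s x)) (at t)"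
      unfolding x_def y_def
      by (rule derivative_eq_intros dx[unfolded x_def] dy[unfolded y_def] refl)+
    moreover have "((\<lambda>t. s (flow t) + s (flow (t + \<tau>))) has_real_derivative
        m * sin x * cos x + m * sin y * cos y) (at t)"
      by (rule DERIV_add[OF dsx dsy])
    ultimately have "(Q has_real_derivative (cos (y - x) * (s y - s x) * (s x + s y) -
        sin (y - x) * (m * sin x * cos x + m * sin y * cos y)) / ((s x + s y) * (s x + s y))) (at t)"
      unfolding Q_def x_def y_def
      by (rule DERIV_divide) (use pos in \<open>simp add: x_def y_def\<close>)
    then show ?thesis using 0 by simp
  qed
  then have "Q t = Q 0" for t using DERIV_isconst_all by blast
  moreover have "s (flow t) + s (flow (t + \<tau>)) \<noteq> 0" for t
    using s_pos[of "flow t"] s_pos[of "flow (t + \<tau>)"] by simp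
  ultimately show ?thesis by (intro that[of "Q 0"]) (metis Q_def nonzero_eq_divide_eq)
qed

subsection \<open>Tangent chords\<close>

text \<open>Tangency identifies the squares of \<open>sin (y - x) - m * sin (x + y)\<close> and
  \<open>sin (y - x) + m * sin (x + y)\<close> with those of \<open>2 * s x\<close> and
  \<open>2 * s y\<close>. All four numbers are positive, so roots can be taken.\<close>

lemma edge_sin:
  assumes "edge x y"
  shows "sin (y - x) = s x + s y" and "sin (y - x) - m * sin (x + y) = 2 * s x"
proof -
  define C S D N where "C = cos (y - x)" and "S = sin (y - x)"
    and "D = cos (x + y)" and "N = sin (x + y)"
  have C: "C = m * D + a\<^sup>2 + b\<^sup>2 - 1" using assms by (simp add: edge_def C_def D_def)
  have S: "S > 0" unfolding S_def using assms by (intro sin_gt_zero) (auto simp: edge_def)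
  have C2: "C\<^sup>2 + S\<^sup>2 = 1" and D2: "D\<^sup>2 + N\<^sup>2 = 1"
    by (auto simp: C_def S_def D_def N_def)
  have D1: "\<bar>D\<bar> \<le> 1" by (simp add: D_def)
  \<comment> \<open>Once \<open>C\<close> is eliminated, the terms in \<open>D\<^sup>2\<close>
    cancel. The right side interpolates the remaining affine function between \<open>D = -1\<close>
    and \<open>D = 1\<close>, where it is positive.\<close>
  have "S\<^sup>2 - (m * N)\<^sup>2 = 2 * (a\<^sup>2 * (1 - a\<^sup>2) * (1 + D) + b\<^sup>2 * (1 - b\<^sup>2) * (1 - D))"
    using C2 D2 C unfolding m_def by algebra
  also have "\<dots> > 0"
  proof (cases "D = 1")
    case True
    then show ?thesis using sq_less_1 by simp
  next
    case False
    then show ?thesis using sq_less_1 D1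
      by (intro mult_pos_pos add_nonneg_pos mult_nonneg_nonneg) auto
  qed
  finally have "\<bar>m * N\<bar> < \<bar>S\<bar>" by (meson abs_le_square_iff diff_gt_0_iff_gt linorder_not_le)
  then have lt: "m * N < S" "- (m * N) < S" using S by auto
  \<comment> \<open>Expand the squares, with \<open>2 * x\<close> and \<open>2 * y\<close> as
    difference and sum of \<open>x + y\<close> and \<open>y - x\<close>; tangency supplies the value
    of \<open>C - m * D\<close>.\<close>
  have eq: "(S - m * N)\<^sup>2 = (2 * s x)\<^sup>2" "(S + m * N)\<^sup>2 = (2 * s y)\<^sup>2"
  proof -
    have x: "cos (2 * x) = C * D + S * N" "cos (2 * y) = C * D - S * N"
      using cos_diff[of "x + y" "y - x"] cos_add[of "x + y" "y - x"]
      by (auto simp: C_def D_def S_def N_def mult.commute)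
    have g: "4 * g z = 2 * (a\<^sup>2 + b\<^sup>2) - 2 * m * cos (2 * z) - 4 * a\<^sup>2 * b\<^sup>2" for z
      unfolding g_def m_def cos_double_cos sin_squared_eq by algebra
    have CD: "C - m * D = a\<^sup>2 + b\<^sup>2 - 1" using C by linarith
    have k: "1 + m\<^sup>2 - (C - m * D)\<^sup>2 = 2 * (a\<^sup>2 + b\<^sup>2) - 4 * a\<^sup>2 * b\<^sup>2"
      unfolding CD by (simp add: m_def power2_eq_square algebra_simps)
    have "(S - m * N)\<^sup>2 = (C\<^sup>2 + S\<^sup>2) + m\<^sup>2 * (D\<^sup>2 + N\<^sup>2) - (C - m * D)\<^sup>2 - 2 * m * (C * D + S * N)"
      "(S + m * N)\<^sup>2 = (C\<^sup>2 + S\<^sup>2) + m\<^sup>2 * (D\<^sup>2 + N\<^sup>2) - (C - m * D)\<^sup>2 - 2 * m * (C * D - S * N)"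
      by (simp_all add: power2_eq_square algebra_simps)
    then show "(S - m * N)\<^sup>2 = (2 * s x)\<^sup>2" "(S + m * N)\<^sup>2 = (2 * s y)\<^sup>2"
      using g[of x] g[of y] k unfolding C2 D2 x by (simp_all add: power_mult_distrib s_square)
  qed
  have "S - m * N = 2 * s x" "S + m * N = 2 * s y"
    using eq lt s_pos[of x] s_pos[of y] by (auto intro: power2_eq_imp_eq)
  then show "sin (y - x) = s x + s y" "sin (y - x) - m * sin (x + y) = 2 * s x"
    by (auto simp: S_def N_def)
qed

lemma abs_m_less_1: "\<bar>m\<bar> < 1"
  unfolding m_def using sq_less_1 by linarith

text \<open>With \<open>x\<close> given, the equation of an edge and the second equation of \<open>edge_sin\<close> are linear in
  \<open>cos y\<close> and \<open>sin y\<close>.\<close>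
lemma edge_unique:
  assumes "edge x y" "edge x z"
  shows "y = z"
proof -
  define p q where "p = (1 - m) * cos x" and "q = (1 + m) * sin x"
  have c: "p * cos w + q * sin w = a\<^sup>2 + b\<^sup>2 - 1" if "edge x w" for w
    using that by (simp add: edge_def p_def q_def cos_add cos_diff algebra_simps)
  have s: "p * sin w - q * cos w = 2 * s x" if "edge x w" for w
    using edge_sin(2)[OF that] by (simp add: p_def q_def sin_add sin_diff algebra_simps)
  \<comment> \<open>The determinant of the linear system for \<open>cos w\<close> and
    \<open>sin w\<close>.\<close>
  have nz: "p\<^sup>2 + q\<^sup>2 \<noteq> 0"
  proof
    assume "p\<^sup>2 + q\<^sup>2 = 0"
    then have "cos x = 0" "sin x = 0" using abs_m_less_1 by (auto simp: p_def q_def sum_power2_eq_zero_iff)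
    then show False using sin_cos_squared_add[of x] by simp
  qed
  have "(p\<^sup>2 + q\<^sup>2) * cos y = (p\<^sup>2 + q\<^sup>2) * cos z" "(p\<^sup>2 + q\<^sup>2) * sin y = (p\<^sup>2 + q\<^sup>2) * sin z"
    using c[OF assms(1)] c[OF assms(2)] s[OF assms(1)] s[OF assms(2)] by algebra+
  then have "cos y = cos z" "sin y = sin z" using nz mult_cancel_left by blast+
  then have "sin (y - z) = 0" by (simp add: sin_diff)
  moreover have "- pi < y - z" "y - z < pi" using assms by (auto simp: edge_def)
  ultimately show "y = z" using sin_eq_0_pi by fastforce
qed

text \<open>An edge forces \<kappa> = 1 for its lag. Then \<open>sin (y - x)\<close> and
  \<open>s x + s y\<close> are interchangeable along the flow, and \<open>g_diff\<close> makes the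
  derivative of the left side of the edge equation vanish.\<close>

lemma edge_transport:
  assumes "edge x y"
  shows "edge (flow t) (flow (t + (elapsed y - elapsed x)))"
proof -
  define \<tau> where "\<tau> = elapsed y - elapsed x"
  obtain \<kappa> where \<kappa>: "\<And>t. sin (flow (t + \<tau>) - flow t) = \<kappa> * (s (flow t) + s (flow (t + \<tau>)))"
    using flow_chord[of \<tau>] by blast
  have "s x + s y > 0" using s_pos by (simp add: add_pos_pos)
  then have "\<kappa> = 1" using \<kappa>[of "elapsed x"] edge_sin(1)[OF assms] by (simp add: \<tau>_def)
  define P where "P t = cos (flow (t + \<tau>) - flow t) - m * cos (flow t + flow (t + \<tau>))" for t
  have "(P has_real_derivative 0) (at t)" for t
  proof -
    define x y where "x = flow t" and "y = flow (t + \<tau>)"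
    have dy: "((\<lambda>t. flow (t + \<tau>)) has_real_derivative s y) (at t)"
      using DERIV_shift[of flow "s y" t \<tau>] flow_has_derivative[of "t + \<tau>"] by (simp add: y_def)
    have dx: "(flow has_real_derivative s x) (at t)"
      using flow_has_derivative[of t] by (simp add: x_def)
    have S: "sin (y - x) = s x + s y" using \<kappa>[of t] \<open>\<kappa> = 1\<close> by (simp add: x_def y_def)
    have "(s y)\<^sup>2 - (s x)\<^sup>2 = m * sin (x + y) * sin (y - x)"
      using g_diff[of y x] by (simp add: s_square)
    then have 0: "- sin (y - x) * (s y - s x) + m * (sin (x + y) * (s x + s y)) = 0"
      using S by algebra
    have "(P has_real_derivative - sin (y - x) * (s y - s x) + m * (sin (x + y) * (s x + s y))) (at t)"
      unfolding P_def x_def y_def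
      by (rule derivative_eq_intros dx[unfolded x_def] dy[unfolded y_def] refl)+
         (simp add: algebra_simps)
    then show ?thesis using 0 by simp
  qed
  then have "P t = P (elapsed x)" for t using DERIV_isconst_all by blast
  then have "P t = a\<^sup>2 + b\<^sup>2 - 1" using assms by (simp add: P_def \<tau>_def edge_def)
  moreover have "\<tau> > 0" using assms by (simp add: \<tau>_def edge_def elapsed_less_iff)
  \<comment> \<open>As \<open>s\<close> has period \<open>pi\<close>, half a turn takes the same
    time from every start, and the lag is shorter than that.\<close>
  moreover have "flow (t + \<tau>) < flow t + pi"
  proof -
    have "s (z + pi) = s z" for z by (simp add: s_def g_def)
    then have "flow (t + (elapsed (x + pi) - elapsed x)) = flow t + pi" by (rule flow_shift)
    moreover have "elapsed y < elapsed (x + pi)" using assms by (simp add: edge_def elapsed_less_iff)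
    then have "flow (t + \<tau>) < flow (t + (elapsed (x + pi) - elapsed x))"
      by (simp add: flow_less_iff \<tau>_def)
    ultimately show ?thesis by simp
  qed
  ultimately show ?thesis by (auto simp: edge_def P_def flow_less_iff simp flip: \<tau>_def)
qed

text \<open>The first edge, transported so that it starts at \<open>x'\<close>, must coincide with
  the second by uniqueness: all tangent chords take the same time.\<close>

lemma edge_elapsed:
  assumes "edge x y" "edge x' y'"
  shows "elapsed y' = elapsed x' + (elapsed y - elapsed x)"
  using edge_unique[OF assms(2)] edge_transport[OF assms(1), of "elapsed x'"] by simp

end

subsection \<open>Sums over closed polygons\<close>

lemma sum_shift_periodic:
  fixes f :: "nat \<Rightarrow> 'a :: ab_group_add"
  assumes "\<And>i. f (i + n) = f i"
  shows "(\<Sum>i<n. f (i + k)) = (\<Sum>i<n. f i)"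
proof (induction k)
  case (Suc k)
  have "(\<Sum>i<n. f (Suc i + k)) - (\<Sum>i<n. f (i + k)) = f (n + k) - f (0 + k)"
    unfolding sum_subtractf[symmetric] by (rule sum_lessThan_telescope)
  then show ?case using Suc assms[of k] by (simp add: add.commute)
qed simp

context unit_circle_ellipse
begin

text \<open>Periodicity is required of the speed, not of the flow: a lifted angle does not return
  after \<open>n\<close> steps of a closed polygon but advances by whole turns.\<close>

lemma sum_cos_flow_const:
  assumes per: "\<And>t. s (flow (t + real n * \<tau>)) = s (flow t)"
  shows "(\<Sum>i<n. cos (flow (t + real (i + k) * \<tau>) - flow (t + real i * \<tau>)))
       = (\<Sum>i<n. cos (flow (t' + real (i + k) * \<tau>) - flow (t' + real i * \<tau>)))"
proof -
  define H where "H t = (\<Sum>i<n. cos (flow (t + real (i + k) * \<tau>) - flow (t + real i * \<tau>)))" for t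
  obtain \<kappa> where \<kappa>: "\<And>t. sin (flow (t + real k * \<tau>) - flow t) = \<kappa> * (s (flow t) + s (flow (t + real k * \<tau>)))"
    using flow_chord[of "real k * \<tau>"] by blast
  have "(H has_real_derivative 0) (at t)" for t
  proof -
    define G where "G i = (s (flow (t + real i * \<tau>)))\<^sup>2" for i
    have d: "((\<lambda>t. flow (t + r)) has_real_derivative s (flow (t + r))) (at t)" for r
      using DERIV_shift[of flow "s (flow (t + r))" t r] flow_has_derivative[of "t + r"] by simp
    have "((\<lambda>t. cos (flow (t + real (i + k) * \<tau>) - flow (t + real i * \<tau>)))
        has_real_derivative - \<kappa> * (G (i + k) - G i)) (at t)" for i
    proof -
      have "sin (flow (t + real (i + k) * \<tau>) - flow (t + real i * \<tau>)) *
          (s (flow (t + real (i + k) * \<tau>)) - s (flow (t + real i * \<tau>))) = \<kappa> * (G (i + k) - G i)"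
        using \<kappa>[of "t + real i * \<tau>"] unfolding G_def
        by (simp add: power2_eq_square algebra_simps)
      then show ?thesis
        by (auto intro!: derivative_eq_intros d simp del: of_nat_add)
    qed
    then have "(H has_real_derivative (\<Sum>i<n. - \<kappa> * (G (i + k) - G i))) (at t)"
      unfolding H_def by (rule DERIV_sum)
    moreover have "(\<Sum>i<n. G (i + k)) = (\<Sum>i<n. G i)"
    proof (rule sum_shift_periodic)
      fix i
      have "t + real (i + n) * \<tau> = t + real i * \<tau> + real n * \<tau>" by (simp add: algebra_simps)
      then show "G (i + n) = G i" unfolding G_def by (simp only: per)
    qed
    then have "(\<Sum>i<n. - \<kappa> * (G (i + k) - G i)) = 0"
      by (simp only: sum_distrib_left[symmetric] sum_subtractf) simp
    ultimately show ?thesis by simp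
  qed
  then have "H t = H t'" using DERIV_isconst_all by blast
  then show ?thesis by (simp add: H_def)
qed

lemma sum_cos_edges:
  assumes \<theta>: "\<And>i. edge (\<theta> i) (\<theta> (Suc i))" and \<phi>: "\<And>i. edge (\<phi> i) (\<phi> (Suc i))"
    and closed: "cis (\<theta> n) = cis (\<theta> 0)"
  shows "(\<Sum>i<n. cos (\<theta> (i + k) - \<theta> i)) = (\<Sum>i<n. cos (\<phi> (i + k) - \<phi> i))"
proof -
  define \<tau> where "\<tau> = elapsed (\<theta> 1) - elapsed (\<theta> 0)"
  \<comment> \<open>Every chain of edges samples the flow at equal time steps, and the step read off
    from \<theta> serves all chains.\<close>
  have *: "\<psi> i = flow (elapsed (\<psi> 0) + real i * \<tau>)" if "\<And>i. edge (\<psi> i) (\<psi> (Suc i))" for \<psi> i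
  proof -
    have "elapsed (\<psi> i) = elapsed (\<psi> 0) + real i * \<tau>"
    proof (induction i)
      case (Suc i)
      then show ?case
        using edge_elapsed[OF \<theta>[of 0] that[of i]] by (simp add: \<tau>_def distrib_right)
    qed simp
    then show ?thesis by (metis flow_elapsed)
  qed
  \<comment> \<open>Closedness makes the total angle a multiple of a full turn, hence a period of
    \<open>s\<close>; the \<open>n\<close> steps together take the time of this advance.\<close>
  have s: "s (x + (\<theta> n - \<theta> 0)) = s x" for x
  proof -
    have "cis (x + (\<theta> n - \<theta> 0)) = cis x" using closed
      by (simp add: cis_mult[symmetric] cis_divide[symmetric])
    then have "cos (x + (\<theta> n - \<theta> 0)) = cos x" "sin (x + (\<theta> n - \<theta> 0)) = sin x"
      by (auto simp: complex_eq_iff)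
    then show ?thesis by (simp add: s_def g_def)
  qed
  have "s (flow (t + real n * \<tau>)) = s (flow t)" for t
  proof -
    have "real n * \<tau> = elapsed (\<theta> 0 + (\<theta> n - \<theta> 0)) - elapsed (\<theta> 0)"
      using arg_cong[OF *[of \<theta>, OF \<theta>, of n], of elapsed] by simp
    then show ?thesis using flow_shift[OF s, of t "\<theta> 0"] s by simp
  qed
  from sum_cos_flow_const[OF this, of "elapsed (\<theta> 0)" k "elapsed (\<phi> 0)"]
  show ?thesis by (simp only: *[of \<theta>, OF \<theta>, symmetric] *[of \<phi>, OF \<phi>, symmetric])
qed

section \<open>Lifting polygons to angles on the real line\<close>

lemma polygon_angles:
  fixes u :: "nat \<Rightarrow> complex"
  assumes unit: "\<And>i. cmod (u i) = 1"
    and pos: "\<And>i. Im (cnj (u i) * u (Suc i)) > 0"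
    and tangent: "\<And>i. (Im (cnj (u i) * u (Suc i)))\<^sup>2 =
      b\<^sup>2 * (Re (u (Suc i) - u i))\<^sup>2 + a\<^sup>2 * (Im (u (Suc i) - u i))\<^sup>2"
  obtains \<theta> where "\<And>i. u i = cis (\<theta> i)" and "\<And>i. edge (\<theta> i) (\<theta> (Suc i))"
proof -
  \<comment> \<open>Turning angles are accumulated without reduction modulo a full turn, so each
    vertex lies ahead of its predecessor, by less than \<open>pi\<close> since the cross products
    are positive.\<close>
  define \<theta> where "\<theta> i = Arg (u 0) + (\<Sum>j<i. Arg (cnj (u j) * u (Suc j)))" for i
  have cis_Arg_unit: "cis (Arg z) = z" if "cmod z = 1" for z
  proof -
    have "z \<noteq> 0" using that by auto
    then show ?thesis using that by (simp add: cis_Arg sgn_eq)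
  qed
  have u: "u i = cis (\<theta> i)" for i
  proof (induction i)
    case 0
    show ?case by (simp add: \<theta>_def cis_Arg_unit unit)
  next
    case (Suc i)
    have "cis (\<theta> (Suc i)) = cis (\<theta> i) * cis (Arg (cnj (u i) * u (Suc i)))"
      by (simp add: \<theta>_def cis_mult add.assoc)
    also have "\<dots> = u i * (cnj (u i) * u (Suc i))"
      using Suc by (subst cis_Arg_unit) (auto simp: norm_mult unit)
    also have "\<dots> = u (Suc i)"
      using unit[of i] complex_norm_square[of "u i"] by (simp add: mult.assoc[symmetric])
    finally show ?case by simp
  qed
  have "edge (\<theta> i) (\<theta> (Suc i))" for i
  proof -
    define x y where "x = \<theta> i" and "y = \<theta> (Suc i)"
    have ux: "u i = cis x" and uy: "u (Suc i) = cis y" by (auto simp: u x_def y_def)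
    have "y - x = Arg (cnj (u i) * u (Suc i))" by (simp add: \<theta>_def x_def y_def)
    then have xy: "0 < y - x" "y - x < pi"
      using pos[of i] Arg_lt_pi[of "cnj (u i) * u (Suc i)"] by metis+
    have S: "Im (cnj (u i) * u (Suc i)) = sin (y - x)"
      unfolding ux uy by (simp add: sin_diff)
    define C D where "C = cos (y - x)" and "D = cos (x + y)"
    have "C < 1" using xy cos_monotone_0_pi[of 0 "y - x"] by (simp add: C_def)
    have 1: "(Re (u (Suc i) - u i))\<^sup>2 = (1 - C) * (1 - D)"
    proof -
      have "(1 - C) * (1 - D) = (1 - cos x * cos y)\<^sup>2 - (sin x)\<^sup>2 * (sin y)\<^sup>2"
        by (simp add: C_def D_def cos_diff cos_add power2_eq_square algebra_simps)
      then show ?thesis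
        unfolding sin_squared_eq ux uy by (simp add: power2_eq_square algebra_simps)
    qed
    have 2: "(Im (u (Suc i) - u i))\<^sup>2 = (1 - C) * (1 + D)"
    proof -
      have "(1 - C) * (1 + D) = (1 - sin x * sin y)\<^sup>2 - (cos x)\<^sup>2 * (cos y)\<^sup>2"
        by (simp add: C_def D_def cos_diff cos_add power2_eq_square algebra_simps)
      then show ?thesis
        unfolding cos_squared_eq ux uy by (simp add: power2_eq_square algebra_simps)
    qed
    have sin2: "(sin (y - x))\<^sup>2 = (1 - C) * (1 + C)"
      by (simp add: sin_squared_eq C_def power2_eq_square algebra_simps)
    \<comment> \<open>All three squares in the tangency condition contain the factor
      \<open>1 - C\<close>, nonzero because consecutive vertices differ; cancelling it leaves the
      edge equation.\<close>
    have "(1 - C) * (1 + C) = (1 - C) * (b\<^sup>2 * (1 - D) + a\<^sup>2 * (1 + D))"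
      using tangent[of i] unfolding S 1 2 sin2 by (simp add: algebra_simps)
    then have "1 + C = b\<^sup>2 * (1 - D) + a\<^sup>2 * (1 + D)" using \<open>C < 1\<close> by simp
    then show ?thesis using xy
      by (simp add: edge_def m_def C_def D_def algebra_simps flip: x_def y_def)
  qed
  then show ?thesis using that u by blast
qed

lemma polygon_sums_eq:
  fixes u v :: "nat \<Rightarrow> complex"
  assumes "\<And>i. cmod (u i) = 1" and "\<And>i. Im (cnj (u i) * u (Suc i)) > 0"
    and "\<And>i. (Im (cnj (u i) * u (Suc i)))\<^sup>2 =
      b\<^sup>2 * (Re (u (Suc i) - u i))\<^sup>2 + a\<^sup>2 * (Im (u (Suc i) - u i))\<^sup>2"
    and "u n = u 0"
    and "\<And>i. cmod (v i) = 1" and "\<And>i. Im (cnj (v i) * v (Suc i)) > 0"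
    and "\<And>i. (Im (cnj (v i) * v (Suc i)))\<^sup>2 =
      b\<^sup>2 * (Re (v (Suc i) - v i))\<^sup>2 + a\<^sup>2 * (Im (v (Suc i) - v i))\<^sup>2"
  shows "(\<Sum>i<n. u i \<bullet> u (i + k)) = (\<Sum>i<n. v i \<bullet> v (i + k))"
proof -
  obtain \<theta> where \<theta>: "\<And>i. u i = cis (\<theta> i)" "\<And>i. edge (\<theta> i) (\<theta> (Suc i))"
    using polygon_angles[of u] assms by metis
  obtain \<phi> where \<phi>: "\<And>i. v i = cis (\<phi> i)" "\<And>i. edge (\<phi> i) (\<phi> (Suc i))"
    using polygon_angles[of v] assms by metis
  have "cis x \<bullet> cis y = cos (y - x)" for x y
    by (simp add: inner_complex_def cos_diff algebra_simps)
  then show ?thesis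
    using sum_cos_edges[of \<theta> \<phi> n k] \<theta> \<phi> assms(4) by simp
qed

end

subsection \<open>Normalisation\<close>

text \<open>Intersections with the line are roots of a quadratic, and tangency makes its
  discriminant vanish. Divided by the squared chord length, the result says that the distance from
  the centre to the line is the support function of the ellipse in the normal direction.\<close>

lemma tangent_line_ellipse:
  assumes "a > 0" "b > 0" "e \<noteq> 0" and tan: "tangent_line (ellipse c a b e) p q"
  defines "P \<equiv> (p - c) / e" and "Q \<equiv> (q - c) / e"
  shows "(Im (cnj P * Q))\<^sup>2 = b\<^sup>2 * (Re (Q - P))\<^sup>2 + a\<^sup>2 * (Im (Q - P))\<^sup>2"
proof -
  define X Y dx dy where "X = Re P" and "Y = Im P" and "dx = Re (Q - P)" and "dy = Im (Q - P)"
  define \<alpha> \<beta> \<gamma> where "\<alpha> = b\<^sup>2 * dx\<^sup>2 + a\<^sup>2 * dy\<^sup>2" and "\<beta> = b\<^sup>2 * X * dx + a\<^sup>2 * Y * dy"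
    and "\<gamma> = b\<^sup>2 * X\<^sup>2 + a\<^sup>2 * Y\<^sup>2 - a\<^sup>2 * b\<^sup>2"
  have pq: "p \<noteq> q" and ex1: "\<exists>!z. z \<in> ellipse c a b e \<and> z \<in> line_through p q"
    using tan by (auto simp: tangent_line_def)
  have "Q \<noteq> P" using pq assms(3) by (simp add: P_def Q_def)
  then have "dx \<noteq> 0 \<or> dy \<noteq> 0" by (auto simp: dx_def dy_def complex_eq_iff)
  then have \<alpha>: "\<alpha> > 0" unfolding \<alpha>_def using assms(1,2)
    by (elim disjE) (simp_all add: add_pos_nonneg add_nonneg_pos)
  have on: "p + of_real t * (q - p) \<in> ellipse c a b e \<longleftrightarrow> \<alpha> * t\<^sup>2 + 2 * \<beta> * t + \<gamma> = 0" for t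
  proof -
    have *: "(p + of_real t * (q - p) - c) / e = P + of_real t * (Q - P)"
      by (simp add: P_def Q_def diff_divide_distrib[symmetric] add_divide_distrib[symmetric])
    have "p + of_real t * (q - p) \<in> ellipse c a b e \<longleftrightarrow> ((X + t * dx) / a)\<^sup>2 + ((Y + t * dy) / b)\<^sup>2 = 1"
      unfolding ellipse_def mem_Collect_eq * by (simp add: X_def Y_def dx_def dy_def)
    also have "\<dots> \<longleftrightarrow> b\<^sup>2 * (X + t * dx)\<^sup>2 + a\<^sup>2 * (Y + t * dy)\<^sup>2 = a\<^sup>2 * b\<^sup>2"
      using assms(1,2) by (simp add: power_divide field_simps) (simp add: eq_commute)
    also have "\<dots> \<longleftrightarrow> \<alpha> * t\<^sup>2 + 2 * \<beta> * t + \<gamma> = 0"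
      unfolding \<alpha>_def \<beta>_def \<gamma>_def by algebra
    finally show ?thesis .
  qed
  obtain t where t: "\<alpha> * t\<^sup>2 + 2 * \<beta> * t + \<gamma> = 0"
    using ex1 on by (auto simp: line_through_def)
  \<comment> \<open>the second root, by Vieta; uniqueness of the intersection point forces a double root\<close>
  define t' where "t' = - 2 * \<beta> / \<alpha> - t"
  have at': "\<alpha> * t' = - 2 * \<beta> - \<alpha> * t" using \<alpha> by (simp add: t'_def field_simps)
  have "\<alpha> * t'\<^sup>2 + 2 * \<beta> * t' + \<gamma> = 0"
    using at' t by algebra
  then have "p + of_real t * (q - p) = p + of_real t' * (q - p)"
    using t ex1 on unfolding line_through_def by blast
  then have "t' = t" using pq by simp
  then have "\<alpha> * t = - \<beta>" using at' by simp
  then have "\<beta>\<^sup>2 = \<alpha> * \<gamma>" using t by algebra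
  \<comment> \<open>By a Lagrange-type identity,
    \<open>\<alpha> * \<gamma> - \<beta>\<^sup>2\<close> equals \<open>a\<^sup>2 * b\<^sup>2 * ((X *
    dy - Y * dx)\<^sup>2 - \<alpha>)\<close>.\<close>
  then have "a\<^sup>2 * b\<^sup>2 * (X * dy - Y * dx)\<^sup>2 = a\<^sup>2 * b\<^sup>2 * \<alpha>"
    unfolding \<alpha>_def \<beta>_def \<gamma>_def by algebra
  then have "(X * dy - Y * dx)\<^sup>2 = \<alpha>" using assms(1,2) by simp
  moreover have "Im (cnj P * Q) = X * dy - Y * dx"
    by (simp add: X_def Y_def dx_def dy_def algebra_simps)
  ultimately show ?thesis by (simp add: \<alpha>_def dx_def dy_def)
qed

lemma cos_vangle: "x \<noteq> 0 \<Longrightarrow> y \<noteq> 0 \<Longrightarrow> cos (vangle x y) = (x \<bullet> y) / (norm x * norm y)"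
  using Cauchy_Schwarz_ineq2[of x y] by (simp add: vangle_def cos_arccos_abs abs_divide)

lemma axes_less_radius:
  assumes "a > 0" "b > 0" "cmod e = 1" "ellipse c a b e \<subseteq> ball c R"
  shows "a < R" "b < R"
proof -
  have "e \<noteq> 0" using assms(3) by auto
  \<comment> \<open>One endpoint of each principal axis.\<close>
  then have "c + of_real a * e \<in> ellipse c a b e" "c + \<i> * of_real b * e \<in> ellipse c a b e"
    using assms(1,2) by (auto simp: ellipse_def)
  then have "c + of_real a * e \<in> ball c R" "c + \<i> * of_real b * e \<in> ball c R"
    using assms(4) by auto
  then show "a < R" "b < R" using assms(1-3) by (auto simp: dist_norm norm_mult)
qed

text \<open>Dividing by \<open>e\<close> aligns the axes of the ellipse with the coordinate axes,
  and dividing by \<open>R\<close> makes the circle the unit circle. Angles at the centre and the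
  rotational sense survive.\<close>

lemma normalised_polygon:
  assumes "R > 0" "a > 0" "b > 0" "cmod e = 1"
    and ngon: "poncelet_ngon (sphere c R) (ellipse c a b e) n u"
  defines "U \<equiv> \<lambda>i. (u i - c) / (of_real R * e)"
  shows "cmod (U i) = 1"
    and "(Im (cnj (U i) * U (Suc i)))\<^sup>2 =
      (b / R)\<^sup>2 * (Re (U (Suc i) - U i))\<^sup>2 + (a / R)\<^sup>2 * (Im (U (Suc i) - U i))\<^sup>2"
    and "Im (cnj (U i) * U (Suc i)) = cross_at c (u i) (u (Suc i)) / R\<^sup>2"
    and "U n = U 0"
    and "cos (vangle (u i - c) (u j - c)) = U i \<bullet> U j"
proof -
  have R: "R\<^sup>2 \<noteq> 0" using assms(1) by simp
  have e: "e \<noteq> 0" "e * cnj e = 1" using assms(4) complex_norm_square[of e] by auto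
  have norm_u: "cmod (u i - c) = R" for i
    using ngon by (auto simp: poncelet_ngon_def dist_norm norm_minus_commute)
  then show "cmod (U i) = 1" using assms(1,4) by (simp add: U_def norm_divide norm_mult)
  show "U n = U 0" using ngon unfolding poncelet_ngon_def U_def by (metis add_0)
  have UU: "cnj (U i) * U j = cnj (u i - c) * (u j - c) / of_real (R\<^sup>2)" for i j
  proof -
    have "cnj (U i) * U j = cnj (u i - c) * (u j - c) / (of_real (R\<^sup>2) * (e * cnj e))"
      by (simp add: U_def power2_eq_square mult_ac)
    then show ?thesis by (simp add: e)
  qed
  then show "Im (cnj (U i) * U (Suc i)) = cross_at c (u i) (u (Suc i)) / R\<^sup>2"
    by (simp only: cross_at_def Im_divide_of_real)
  show "cos (vangle (u i - c) (u j - c)) = U i \<bullet> U j"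
  proof -
    have "u i - c \<noteq> 0" for i using norm_u[of i] assms(1) by auto
    then have "cos (vangle (u i - c) (u j - c)) = ((u i - c) \<bullet> (u j - c)) / (R * R)"
      by (simp add: cos_vangle norm_u del: right_minus_eq)
    also have "\<dots> = Re (cnj (u i - c) * (u j - c)) / R\<^sup>2"
      by (simp add: inner_complex_def power2_eq_square algebra_simps)
    also have "\<dots> = Re (cnj (U i) * U j)" by (simp only: UU Re_divide_of_real)
    finally show ?thesis by (simp add: inner_complex_def)
  qed
  have tan: "tangent_line (ellipse c a b e) (u i) (u (Suc i))"
    using ngon by (simp add: poncelet_ngon_def)
  have "(u i - c) / e = of_real R * U i" for i using assms(1) e by (simp add: U_def)
  from tangent_line_ellipse[OF assms(2,3) e(1) tan, unfolded this]
  have "(R\<^sup>2 * Im (cnj (U i) * U (Suc i)))\<^sup>2 =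
      b\<^sup>2 * (R * Re (U (Suc i) - U i))\<^sup>2 + a\<^sup>2 * (R * Im (U (Suc i) - U i))\<^sup>2"
    by (simp add: algebra_simps power2_eq_square)
  \<comment> \<open>Rescaling produces degree 4 in \<open>R\<close> on the left but degree 2 on the
    right; the common factor is isolated for cancellation.\<close>
  then have "R\<^sup>2 * (R\<^sup>2 * (Im (cnj (U i) * U (Suc i)))\<^sup>2) = R\<^sup>2 *
      (b\<^sup>2 * (Re (U (Suc i) - U i))\<^sup>2 + a\<^sup>2 * (Im (U (Suc i) - U i))\<^sup>2)"
    by algebra
  then have "R\<^sup>2 * (Im (cnj (U i) * U (Suc i)))\<^sup>2 =
      b\<^sup>2 * (Re (U (Suc i) - U i))\<^sup>2 + a\<^sup>2 * (Im (U (Suc i) - U i))\<^sup>2"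
    unfolding mult_left_cancel[OF R] .
  then show "(Im (cnj (U i) * U (Suc i)))\<^sup>2 =
      (b / R)\<^sup>2 * (Re (U (Suc i) - U i))\<^sup>2 + (a / R)\<^sup>2 * (Im (U (Suc i) - U i))\<^sup>2"
    using assms(1) by (simp add: power_divide divide_simps) (simp add: mult_ac)
qed

text \<open>The Poncelet family of \<open>u\<close> is represented by an arbitrary polygon
  \<open>v\<close> for the same pair with the same rotational sense: a starting point and a sense
  determine every further vertex.\<close>

theorem theorem6p2:
  fixes c e :: complex and R a b :: real and n k :: nat and u v :: "nat \<Rightarrow> complex"
  assumes "R > 0" and "a > 0" and "b > 0" and "cmod e = 1"
    and "ellipse c a b e \<subseteq> ball c R"
    and "poncelet_ngon (sphere c R) (ellipse c a b e) n u"
    and "poncelet_ngon (sphere c R) (ellipse c a b e) n v"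
    and "\<forall>i j. cross_at c (u i) (u (Suc i)) * cross_at c (v j) (v (Suc j)) > 0"
  shows "(\<Sum>i<n. cos (vangle (u i - c) (u (i + k) - c)))
       = (\<Sum>i<n. cos (vangle (v i - c) (v (i + k) - c)))"
proof -
  interpret unit_circle_ellipse "a / R" "b / R"
    by unfold_locales (use assms(1-3) axes_less_radius[OF assms(2-5)] in auto)
  define U V where "U = (\<lambda>i. (u i - c) / (of_real R * e))" and "V = (\<lambda>i. (v i - c) / (of_real R * e))"
  have UV: "(u i - c) / (of_real R * e) = U i" "(v i - c) / (of_real R * e) = V i" for i
    by (auto simp: U_def V_def)
  note U = normalised_polygon[OF assms(1-4) assms(6), unfolded UV]
  note V = normalised_polygon[OF assms(1-4) assms(7), unfolded UV]
  have "(\<Sum>i<n. U i \<bullet> U (i + k)) = (\<Sum>i<n. V i \<bullet> V (i + k))"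
  \<comment> \<open>The sign of one cross product fixes the signs of all of them, for both polygons,
    since every mixed product is positive.\<close>
  proof (cases "cross_at c (u 0) (u (Suc 0)) > 0")
    case True
    then have v: "cross_at c (v j) (v (Suc j)) > 0" for j
      using assms(8) zero_less_mult_pos by blast
    then have "cross_at c (u i) (u (Suc i)) > 0" for i
      using assms(8) zero_less_mult_pos2 by blast
    then have "Im (cnj (U i) * U (Suc i)) > 0" "Im (cnj (V i) * V (Suc i)) > 0" for i
      unfolding U(3) V(3) using v assms(1) by auto
    then show ?thesis by (intro polygon_sums_eq U(1,2,4) V(1,2))
  next
    case False
    then have v: "cross_at c (v j) (v (Suc j)) < 0" for j
      using assms(8) by (metis zero_less_mult_iff)
    then have u: "cross_at c (u i) (u (Suc i)) < 0" for i
      using assms(8) by (metis zero_less_mult_iff order_less_asym)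
    have neg: "Im (cnj (U i) * U (Suc i)) < 0" "Im (cnj (V i) * V (Suc i)) < 0" for i
      unfolding U(3) V(3) using u v assms(1) by (auto intro: divide_neg_pos)
    \<comment> \<open>reflecting in the major or minor axis reverses the orientation\<close>
    have cnj: "Im (cnj (cnj z) * cnj w) = - Im (cnj z * w)"
        "(Re (cnj w - cnj z))\<^sup>2 = (Re (w - z))\<^sup>2" "(Im (cnj w - cnj z))\<^sup>2 = (Im (w - z))\<^sup>2" for z w
      by (auto simp: power2_commute)
    have "(\<Sum>i<n. cnj (U i) \<bullet> cnj (U (i + k))) = (\<Sum>i<n. cnj (V i) \<bullet> cnj (V (i + k)))"
      by (rule polygon_sums_eq[of "\<lambda>i. cnj (U i)" n "\<lambda>i. cnj (V i)"])
         (simp_all only: cnj power2_minus complex_mod_cnj U(1,2,4) V(1,2) neg_0_less_iff_less neg)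
    then show ?thesis by (simp add: inner_complex_def)
  qed
  then show ?thesis by (simp only: U(5) V(5))
qed

end
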